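(* Let $q$ be a prime power and let $n,k,r\ge 1$ be integers such that $n\le q$, $(r+1)\mid n$, $r\mid k$ and $k\le \frac{rn}{r+1}$. Let $A\subseteq\mathbb{F}_q$ with $|A|=n$, let $\mathcal{A}=\{A_1,\dots,A_{n/(r+1)}\}$ be a partition of $A$ into sets of size $r+1$, and let $g\in\mathbb{F}_q[x]$ be a polynomial of degree $r+1$ that is constant on each set $A_i$. For $a=(a_{ij})_{0\le i\le r-1,\ 0\le j\le k/r-1}\in\mathbb{F}_q^k$ put $$f_a(x)=\sum_{i=0}^{r-1}\Big(\sum_{j=0}^{k/r-1}a_{ij}\,g(x)^j\Big)x^i ,$$ and let $\mathcal{C}=\{(f_a(\alpha))_{\alpha\in A}: a\in\mathbb{F}_q^k\}\subseteq\mathbb{F}_q^n$. Then the linear code $\mathcal{C}$ has dimension $k$ and is an optimal $(n,k,r)$ LRC code, i.e. it has locality $r$ and its minimum distance equals $$d=n-k-\Big\lceil\frac{k}{r}\Big\rceil+2 .$$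
   Context: A code $\mathcal{C}\subseteq\mathbb{F}_q^n$ has locality $r$ if for every coordinate $i$ there is a set $I_i$ of at most $r$ coordinates, not containing $i$, such that for codewords $x\in\mathcal{C}$ the symbol $x_i$ is a function of the symbols $(x_l)_{l\in I_i}$. An $(n,k,r)$ LRC (locally recoverable) code is a code of length $n$, cardinality $q^k$ and locality $r$. Every $(n,k,r)$ LRC code has minimum distance at most $n-k-\lceil k/r\rceil+2$; a code attaining this with equality is called optimal. Codeword coordinates are indexed by the elements of $A$. *)

theory Defs
  imports
    Complex_Main
    "HOL-Library.Cardinality"
    "HOL-Library.Disjoint_Sets"
    "HOL-Library.FuncSet"
    "HOL-Library.Function_Algebras"
    "HOL-Computational_Algebra.Polynomial"
begin

text \<open>
  A word over a field with coordinates indexed by a finite set \<open>A\<close> is a function that vanishes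
  outside \<open>A\<close>.  With this encoding the words over \<open>A\<close> form a linear subspace of the function space,
  whose additive structure is the pointwise one of \<^theory>\<open>HOL-Library.Function_Algebras\<close>.
\<close>

definition word_space :: "'i set \<Rightarrow> ('i \<Rightarrow> 'a::zero) set" where
  "word_space A = {x. \<forall>i. i \<notin> A \<longrightarrow> x i = 0}"

definition word_scale :: "'a::field \<Rightarrow> ('i \<Rightarrow> 'a) \<Rightarrow> 'i \<Rightarrow> 'a" where
  "word_scale c x = (\<lambda>i. c * x i)"

global_interpretation word: vector_space "word_scale :: 'a::field \<Rightarrow> ('i \<Rightarrow> 'a) \<Rightarrow> 'i \<Rightarrow> 'a"
  by standard (simp_all add: word_scale_def fun_eq_iff algebra_simps)

definition hamming_distance :: "'i set \<Rightarrow> ('i \<Rightarrow> 'a) \<Rightarrow> ('i \<Rightarrow> 'a) \<Rightarrow> nat" where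
  "hamming_distance A x y = card {i \<in> A. x i \<noteq> y i}"

text \<open>Meaningful for finite \<open>A\<close> and codes with at least two codewords.\<close>

definition min_distance :: "'i set \<Rightarrow> ('i \<Rightarrow> 'a) set \<Rightarrow> nat" where
  "min_distance A C = Min {hamming_distance A x y | x y. x \<in> C \<and> y \<in> C \<and> x \<noteq> y}"

text \<open>
  The recovery function \<open>\<phi>\<close> is applied to the restriction of \<open>x\<close> to the recovering set \<open>I\<close>, so
  that it has access to the symbols with index in \<open>I\<close> only.
\<close>

definition has_locality :: "'i set \<Rightarrow> ('i \<Rightarrow> 'a) set \<Rightarrow> nat \<Rightarrow> bool" where
  "has_locality A C r \<longleftrightarrow>
     (\<forall>i\<in>A. \<exists>I. I \<subseteq> A \<and> i \<notin> I \<and> finite I \<and> card I \<le> r \<and>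
        (\<exists>\<phi> :: ('i \<Rightarrow> 'a) \<Rightarrow> 'a. \<forall>x\<in>C. x i = \<phi> (restrict x I)))"

definition lrc_code ::
    "'i set \<Rightarrow> ('i \<Rightarrow> 'a::{finite,field}) set \<Rightarrow> nat \<Rightarrow> nat \<Rightarrow> nat \<Rightarrow> bool" where
  "lrc_code A C n k r \<longleftrightarrow>
     finite A \<and> card A = n \<and> C \<subseteq> word_space A \<and> card C = CARD('a) ^ k \<and> has_locality A C r"

definition optimal_lrc_code ::
    "'i set \<Rightarrow> ('i \<Rightarrow> 'a::{finite,field}) set \<Rightarrow> nat \<Rightarrow> nat \<Rightarrow> nat \<Rightarrow> bool" where
  "optimal_lrc_code A C n k r \<longleftrightarrow>
     lrc_code A C n k r \<and>
     int (min_distance A C) = int n - int k - \<lceil>real k / real r\<rceil> + 2"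

definition message_space :: "nat \<Rightarrow> nat \<Rightarrow> (nat \<times> nat \<Rightarrow> 'a) set" where
  "message_space r k = ({..<r} \<times> {..<k div r}) \<rightarrow>\<^sub>E UNIV"

definition encoding_poly ::
    "'a::field poly \<Rightarrow> nat \<Rightarrow> nat \<Rightarrow> (nat \<times> nat \<Rightarrow> 'a) \<Rightarrow> 'a poly" where
  "encoding_poly g r k a =
     (\<Sum>i<r. (\<Sum>j<k div r. smult (a (i, j)) (g ^ j)) * monom 1 i)"

definition evaluation_word :: "'a::field set \<Rightarrow> 'a poly \<Rightarrow> 'a \<Rightarrow> 'a" where
  "evaluation_word A f = (\<lambda>\<alpha>. if \<alpha> \<in> A then poly f \<alpha> else 0)"

definition evaluation_code ::
    "'a::field set \<Rightarrow> 'a poly \<Rightarrow> nat \<Rightarrow> nat \<Rightarrow> ('a \<Rightarrow> 'a) set" where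
  "evaluation_code A g r k =
     {evaluation_word A (encoding_poly g r k a) | a. a \<in> message_space r k}"

end

theory Submission imports Defs
begin

text \<open>
  The products \<open>g ^ j * x ^ i\<close> with \<open>i < r\<close>, \<open>j < k div r\<close> have pairwise distinct degrees, all below
  \<open>n\<close>, so their evaluation words form a basis of the code and every nonzero codeword vanishes on at
  most \<open>k + k div r - 2\<close> points.  On a block \<open>g\<close> is constant, so a codeword is there the
  evaluation of a polynomial of degree below \<open>r\<close>, and \<open>r\<close> of the \<open>r + 1\<close> symbols determine the
  last one.  The distance is attained by the product of the \<open>g - g(B)\<close> over \<open>k div r - 1\<close> blocks
  \<open>B\<close> and of \<open>r - 1\<close> linear factors with roots in one further block.
\<close>

section \<open>Expansions in powers of a polynomial\<close>

text \<open>Splitting off the lowest digit writes \<open>h 0\<close> as a multiple of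
  \<open>g\<close>. A multiple of \<open>g\<close> of degree below \<open>degree g\<close> is zero,
  so the cofactor \<open>s\<close> vanishes too, and it is an expansion with one digit
  fewer.\<close>

lemma g_adic_expansion_zero:
  fixes g :: "'a::field poly"
  assumes "\<And>j. j < m \<Longrightarrow> degree (h j) < degree g"
    and "(\<Sum>j<m. h j * g ^ j) = 0" and "j < m"
  shows "h j = 0"
  using assms
proof (induction m arbitrary: h j)
  case 0
  then show ?case by simp
next
  case (Suc m)
  define s where "s = (\<Sum>j<m. h (Suc j) * g ^ j)"
  have "(\<Sum>j<Suc m. h j * g ^ j) = h 0 + g * s"
    by (simp add: sum.lessThan_Suc_shift s_def sum_distrib_left algebra_simps del: sum.lessThan_Suc)
  then have eq: "h 0 = - (g * s)"
    using Suc.prems(2) by (simp add: eq_neg_iff_add_eq_0)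
  have deg0: "degree (h 0) < degree g"
    using Suc.prems(1) by simp
  have s0: "s = 0"
  proof (rule ccontr)
    assume "s \<noteq> 0"
    moreover have "g \<noteq> 0" using deg0 by auto
    ultimately have "degree (h 0) = degree g + degree s"
      by (simp add: eq degree_mult_eq)
    with deg0 show False by simp
  qed
  have "h (Suc i) = 0" if "i < m" for i
    using Suc.IH[of "\<lambda>j. h (Suc j)" i] Suc.prems(1) s0 that by (simp add: s_def)
  then show ?case
    using eq s0 Suc.prems(3) by (cases j) auto
qed

text \<open>Swapping the two sums regroups the polynomial by powers of \<open>g\<close>. For
  \<open>r \<ge> 1\<close> and \<open>degree g = r + 1\<close> the inner sums are
  base-\<open>g\<close> digits, so uniqueness of the expansion applies to them.\<close>

lemma encoding_poly_g_adic:
  "encoding_poly g r k a = (\<Sum>j<k div r. (\<Sum>i<r. monom (a (i, j)) i) * g ^ j)"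
proof -
  have "smult c p * monom 1 i = monom c i * p" for c :: 'a and p i
    by (metis mult.commute mult.right_neutral mult_smult_left smult_monom)
  then show ?thesis
    unfolding encoding_poly_def sum_distrib_right by (subst sum.swap) simp
qed

text \<open>This flat form shows linearity in the message and isolates the products that become the
  basis of the code.\<close>

lemma encoding_poly_Times:
  "encoding_poly g r k a =
     (\<Sum>p\<in>{..<r} \<times> {..<k div r}. smult (a p) (g ^ snd p * monom 1 (fst p)))"
  by (simp add: encoding_poly_def sum_distrib_right sum.cartesian_product case_prod_unfold)

lemma degree_sum_monom_less:
  "r \<ge> 1 \<Longrightarrow> degree (\<Sum>i<r. monom (c i) i) < r"
  by (rule degree_lessI) (auto simp: coeff_sum)

text \<open>By uniqueness of the base-\<open>g\<close> expansion every digit is the zero polynomial,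
  and the message symbols are the coefficients of the digits.\<close>

lemma encoding_poly_eq_0D:
  fixes g :: "'a::field poly"
  assumes "r \<ge> 1" "degree g = r + 1" "encoding_poly g r k a = 0" "i < r" "j < k div r"
  shows "a (i, j) = 0"
proof -
  have "degree (\<Sum>i<r. monom (a (i, j)) i) < degree g" for j
    using degree_sum_monom_less[OF assms(1), of "\<lambda>i. a (i, j)"] assms(2) by simp
  then have "(\<Sum>i<r. monom (a (i, j)) i) = 0"
    using g_adic_expansion_zero[of "k div r" "\<lambda>j. \<Sum>i<r. monom (a (i, j)) i" g j] assms(3,5)
    by (simp add: encoding_poly_g_adic)
  then have "coeff (\<Sum>i<r. monom (a (i, j)) i) i = 0" by simp
  then show ?thesis using assms(4) by (simp add: coeff_sum)
qed

text \<open>With \<open>m = k div r\<close>, a digit contributes at most \<open>r - 1\<close> and a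
  power of \<open>g\<close> at most \<open>(m - 1) * (r + 1)\<close>, which add up to
  \<open>k + m - 2\<close>. The 2 stands on the left to avoid truncated subtraction.\<close>

lemma degree_encoding_poly:
  fixes g :: "'a::field poly"
  assumes "k \<ge> 1" "r \<ge> 1" "r dvd k" "degree g = r + 1"
  shows "degree (encoding_poly g r k a) + 2 \<le> k + k div r"
proof -
  obtain m where m: "k = r * m" using assms(3) by blast
  have div: "k div r = m" using m assms(2) by simp
  have m1: "m \<ge> 1" using m assms(1) by (cases m) auto
  have "degree (encoding_poly g r k a) \<le> (r - 1) + (m - 1) * (r + 1)"
    unfolding encoding_poly_g_adic div
  proof (rule degree_sum_le)
    fix j assume "j \<in> {..<m}"
    then have "j \<le> m - 1" by auto
    have "degree ((\<Sum>i<r. monom (a (i, j)) i) * g ^ j)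
        \<le> degree (\<Sum>i<r. monom (a (i, j)) i) + degree (g ^ j)"
      by (rule degree_mult_le)
    also have "\<dots> \<le> (r - 1) + (m - 1) * (r + 1)"
    proof (rule add_mono)
      show "degree (\<Sum>i<r. monom (a (i, j)) i) \<le> r - 1"
        using degree_sum_monom_less[OF assms(2), of "\<lambda>i. a (i, j)"] by simp
      have "degree (g ^ j) \<le> degree g * j" by (rule degree_power_le)
      also have "\<dots> \<le> (m - 1) * (r + 1)"
        using \<open>j \<le> m - 1\<close> assms(4) by (simp add: mult.commute mult_le_mono del: mult_Suc mult_Suc_right)
      finally show "degree (g ^ j) \<le> (m - 1) * (r + 1)" .
    qed
    finally show "degree ((\<Sum>i<r. monom (a (i, j)) i) * g ^ j) \<le> (r - 1) + (m - 1) * (r + 1)" .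
  qed simp
  \<comment> \<open>Writing \<open>m\<close> and \<open>r\<close> as successors removes the
    natural-number subtractions before the final arithmetic.\<close>
  moreover obtain m' where "m = Suc m'" using m1 by (cases m) auto
  moreover obtain r' where "r = Suc r'" using assms(2) by (cases r) auto
  ultimately show ?thesis using div m by (simp add: algebra_simps)
qed

section \<open>Linearity of the encoding and membership in its image\<close>

lemma encoding_poly_diff:
  "encoding_poly g r k a - encoding_poly g r k b = encoding_poly g r k (\<lambda>p. a p - b p)"
  by (simp add: encoding_poly_Times smult_diff_left sum_subtractf)

lemma encoding_poly_cong:
  "(\<And>p. p \<in> {..<r} \<times> {..<k div r} \<Longrightarrow> a p = b p) \<Longrightarrow> encoding_poly g r k a = encoding_poly g r k b"
  by (simp add: encoding_poly_Times)

text \<open>Messages are extensional functions, but the encoding reads only the entries in the index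
  rectangle, so an arbitrary coefficient function can first be restricted to it.\<close>

lemma evaluation_word_encoding_poly_in_code:
  "evaluation_word A (encoding_poly g r k a) \<in> evaluation_code A g r k"
proof -
  have "encoding_poly g r k a = encoding_poly g r k (restrict a ({..<r} \<times> {..<k div r}))"
    by (rule encoding_poly_cong) auto
  moreover have "restrict a ({..<r} \<times> {..<k div r}) \<in> message_space r k"
    by (simp add: message_space_def)
  ultimately show ?thesis unfolding evaluation_code_def by auto
qed

lemma smult_sum_right: "smult c (\<Sum>i\<in>S. f i) = (\<Sum>i\<in>S. smult c (f i))"
  by (induction S rule: infinite_finite_induct) (auto simp: smult_add_right)

text \<open>The message with entries \<open>coeff p j * coeff h i\<close> works, since the double
  sum then factors. The lemma supplies the codeword that attains the minimum distance.\<close>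

lemma pcompose_times_in_encoding:
  fixes g :: "'a::field poly"
  assumes "degree p < k div r" "degree h < r"
  shows "\<exists>a. encoding_poly g r k a = pcompose p g * h"
proof
  have h: "(\<Sum>i<r. monom (coeff h i) i) = h"
    by (rule poly_eqI) (use assms(2) in \<open>auto simp: coeff_sum coeff_eq_0\<close>)
  have "pcompose p g = (\<Sum>j\<le>degree p. smult (coeff p j) (g ^ j))"
    by (simp add: pcompose_altdef poly_altdef coeff_map_poly degree_map_poly)
  also have "\<dots> = (\<Sum>j<k div r. smult (coeff p j) (g ^ j))"
    by (rule sum.mono_neutral_left) (use assms(1) in \<open>auto simp: coeff_eq_0\<close>)
  finally have p: "pcompose p g = (\<Sum>j<k div r. smult (coeff p j) (g ^ j))" .
  have "encoding_poly g r k (\<lambda>(i, j). coeff p j * coeff h i)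
      = (\<Sum>j<k div r. (\<Sum>i<r. smult (coeff p j) (monom (coeff h i) i)) * g ^ j)"
    by (simp add: encoding_poly_g_adic smult_monom)
  also have "\<dots> = (\<Sum>j<k div r. smult (coeff p j) h * g ^ j)"
    by (simp only: h flip: smult_sum_right)
  also have "\<dots> = pcompose p g * h"
    by (simp add: p sum_distrib_left mult.commute[of _ h])
  finally show "encoding_poly g r k (\<lambda>(i, j). coeff p j * coeff h i) = pcompose p g * h" .
qed

section \<open>Dimension\<close>

lemma card_roots_le_degree:
  fixes f :: "'a::field poly"
  assumes "f \<noteq> 0" "\<forall>x\<in>S. poly f x = 0"
  shows "card S \<le> degree f"
proof -
  have "card S \<le> card {x. poly f x = 0}"
    by (rule card_mono) (use assms in \<open>auto simp: poly_roots_finite\<close>)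
  also have "\<dots> \<le> degree f" using assms(1) by (rule card_poly_roots_bound)
  finally show ?thesis .
qed

lemma evaluation_word_eq_0D:
  fixes f :: "'a::field poly"
  assumes "degree f < card A" "evaluation_word A f = 0"
  shows "f = 0"
proof (rule ccontr)
  assume "f \<noteq> 0"
  moreover have "\<forall>x\<in>A. poly f x = 0"
    using assms(2) by (simp add: evaluation_word_def fun_eq_iff split: if_splits)
  ultimately have "card A \<le> degree f" by (rule card_roots_le_degree)
  with assms(1) show False by simp
qed

lemma sum_fun_apply: "(\<Sum>s\<in>S. f s) x = (\<Sum>s\<in>S. f s x)"
  by (induction S rule: infinite_finite_induct) auto

lemma evaluation_word_encoding_poly:
  "evaluation_word A (encoding_poly g r k a) =
     (\<Sum>p\<in>{..<r} \<times> {..<k div r}.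
        word_scale (a p) (evaluation_word A (g ^ snd p * monom 1 (fst p))))"
  by (auto simp: fun_eq_iff sum_fun_apply encoding_poly_Times evaluation_word_def word_scale_def
        poly_sum)

text \<open>All four claims come from \<open>lin\<close>: a relation among the words
  \<open>e p\<close> is an encoding polynomial that vanishes on \<open>A\<close> and has degree
  below \<open>card A\<close>, so it is zero and its coefficients vanish. Injectivity of
  \<open>e\<close> is needed because independence concerns only the set of its values, while the
  dimension counts indices.\<close>

lemma evaluation_code_basis:
  fixes g :: "'a::field poly"
  assumes "k \<ge> 1" "r \<ge> 1" "r dvd k" "degree g = r + 1" "k + k div r < card A + 2"
  defines "I \<equiv> {..<r} \<times> {..<k div r}"
    and "e \<equiv> \<lambda>p. evaluation_word A (g ^ snd p * monom 1 (fst p))"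
  shows "inj_on e I" "word.independent (e ` I)" "evaluation_code A g r k = word.span (e ` I)"
    "inj_on (\<lambda>a. evaluation_word A (encoding_poly g r k a)) (message_space r k)"
proof -
  have lin: "a p = 0"
    if "(\<Sum>p\<in>I. word_scale (a p) (e p)) = 0" "p \<in> I" for a p
  proof -
    have "evaluation_word A (encoding_poly g r k a) = 0"
      using that(1) by (simp add: evaluation_word_encoding_poly I_def e_def)
    moreover have "degree (encoding_poly g r k a) < card A"
      using degree_encoding_poly[OF assms(1-4), of a] assms(5) by linarith
    ultimately have "encoding_poly g r k a = 0"
      by (rule evaluation_word_eq_0D[rotated])
    with that(2) show ?thesis
      using encoding_poly_eq_0D[OF assms(2,4)] by (auto simp: I_def)
  qed
  have fin: "finite I" by (simp add: I_def)
  show inj: "inj_on e I"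
  proof (rule inj_onI, rule ccontr)
    fix p p' assume p: "p \<in> I" "p' \<in> I" "e p = e p'" "p \<noteq> p'"
    \<comment> \<open>Two indices with the same word would give the nontrivial relation with
      coefficients 1 and -1.\<close>
    define c where "c = (\<lambda>s. if s = p then 1 else if s = p' then - 1 else 0 :: 'a)"
    have "(\<Sum>s\<in>I. word_scale (c s) (e s)) = (\<Sum>s\<in>{p, p'}. word_scale (c s) (e s))"
      by (rule sum.mono_neutral_right) (use p fin in \<open>auto simp: c_def word_scale_def fun_eq_iff\<close>)
    also have "\<dots> = 0"
      using p(3,4) by (auto simp: c_def word_scale_def fun_eq_iff)
    finally have "c p = 0" using p(1) by (rule lin)
    then show False by (simp add: c_def)
  qed
  show "word.independent (e ` I)"
  proof
    assume "word.dependent (e ` I)"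
    then obtain u x where x: "x \<in> e ` I" "u x \<noteq> 0"
      and sum: "(\<Sum>x\<in>e ` I. word_scale (u x) x) = 0"
      using word.dependent_finite[OF finite_imageI[OF fin], of e] by blast
    from sum have "(\<Sum>p\<in>I. word_scale ((u \<circ> e) p) (e p)) = 0"
      by (simp only: sum.reindex[OF inj] o_def)
    note zero = lin[where a = "u \<circ> e", OF this]
    from x show False using zero by auto
  qed
  show "evaluation_code A g r k = word.span (e ` I)"
  proof
    have "evaluation_word A (encoding_poly g r k a) \<in> word.span (e ` I)" for a
      unfolding evaluation_word_encoding_poly I_def[symmetric]
      by (intro word.span_sum word.span_scale word.span_base) (simp add: e_def)
    then show "evaluation_code A g r k \<subseteq> word.span (e ` I)"
      by (auto simp: evaluation_code_def)
    show "word.span (e ` I) \<subseteq> evaluation_code A g r k"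
    proof
      fix x assume "x \<in> word.span (e ` I)"
      then obtain u where "x = (\<Sum>v\<in>e ` I. word_scale (u v) v)"
        using fin by (auto simp: word.span_finite)
      also have "\<dots> = (\<Sum>p\<in>I. word_scale ((u \<circ> e) p) (e p))"
        by (simp only: sum.reindex[OF inj] o_def)
      also have "\<dots> = evaluation_word A (encoding_poly g r k (u \<circ> e))"
        by (simp only: evaluation_word_encoding_poly I_def e_def)
      finally have "x = evaluation_word A (encoding_poly g r k (u \<circ> e))" .
      then show "x \<in> evaluation_code A g r k"
        by (simp add: evaluation_word_encoding_poly_in_code)
    qed
  qed
  show "inj_on (\<lambda>a. evaluation_word A (encoding_poly g r k a)) (message_space r k)"
  proof (rule inj_onI)
    fix a b :: "nat \<times> nat \<Rightarrow> 'a"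
    assume ab: "a \<in> message_space r k" "b \<in> message_space r k"
      and eq: "evaluation_word A (encoding_poly g r k a) = evaluation_word A (encoding_poly g r k b)"
    \<comment> \<open>\<open>lin\<close> asks for no extensionality, so it applies to the plain
      pointwise difference of the messages.\<close>
    have "evaluation_word A (encoding_poly g r k (\<lambda>p. a p - b p)) = 0"
    proof
      fix x
      show "evaluation_word A (encoding_poly g r k (\<lambda>p. a p - b p)) x = 0 x"
        using fun_cong[OF eq, of x]
        by (cases "x \<in> A") (simp_all add: encoding_poly_diff[symmetric] evaluation_word_def)
    qed
    then have "a p - b p = 0" if "p \<in> I" for p
      using lin[of "\<lambda>p. a p - b p" p] that by (simp add: evaluation_word_encoding_poly I_def e_def)
    then have "a p = b p" if "p \<in> I" for p
      using that by simp
    with ab show "a = b"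
      unfolding message_space_def I_def[symmetric] by (rule PiE_ext)
  qed
qed

section \<open>Locality\<close>

text \<open>If the symbols on \<open>I\<close> determine the symbol at \<open>i\<close>, a recovery
  function exists by choice, so locality reduces to comparing two codewords.\<close>

lemma has_localityI:
  assumes "\<And>i. i \<in> A \<Longrightarrow> \<exists>I. I \<subseteq> A \<and> i \<notin> I \<and> finite I \<and> card I \<le> r \<and>
      (\<forall>x\<in>C. \<forall>y\<in>C. (\<forall>l\<in>I. x l = y l) \<longrightarrow> x i = y i)"
  shows "has_locality A C r"
  unfolding has_locality_def
proof
  fix i assume "i \<in> A"
  then obtain I where I: "I \<subseteq> A" "i \<notin> I" "finite I" "card I \<le> r"
    and det: "\<forall>x\<in>C. \<forall>y\<in>C. (\<forall>l\<in>I. x l = y l) \<longrightarrow> x i = y i"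
    using assms[OF \<open>i \<in> A\<close>] by (elim exE conjE) (rule that)
  \<comment> \<open>The recovery function picks any codeword with the given restriction and reads
    its symbol at \<open>i\<close>; its value on other inputs is irrelevant.\<close>
  define \<phi> where "\<phi> = (\<lambda>w. (SOME y. y \<in> C \<and> restrict y I = w) i)"
  have "x i = \<phi> (restrict x I)" if "x \<in> C" for x
  proof -
    define y where "y = (SOME y. y \<in> C \<and> restrict y I = restrict x I)"
    have "y \<in> C \<and> restrict y I = restrict x I"
      unfolding y_def by (rule someI[of _ x]) (simp add: that)
    then have "y \<in> C" and eq: "restrict y I = restrict x I" by simp_all
    moreover have "\<forall>l\<in>I. x l = y l"
    proof
      fix l assume "l \<in> I"
      then show "x l = y l" using fun_cong[OF eq, of l] by simp
    qed
    ultimately have "x i = y i" using det that by simp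
    then show ?thesis by (simp add: \<phi>_def y_def)
  qed
  then show "\<exists>I\<subseteq>A. i \<notin> I \<and> finite I \<and> card I \<le> r \<and>
      (\<exists>\<phi>. \<forall>x\<in>C. x i = \<phi> (restrict x I))"
    using I by (intro exI[of _ I] conjI exI[of _ \<phi>]) simp_all
qed

text \<open>The recovering set of \<open>i\<close> is its block without \<open>i\<close>. Two
  codewords that agree there differ on the block by a polynomial of degree below \<open>r\<close>
  with \<open>r\<close> roots, hence by zero.\<close>

lemma evaluation_code_has_locality:
  fixes A :: "'a::field set"
  assumes "r \<ge> 1" "partition_on A P" "\<forall>B\<in>P. card B = r + 1"
    and "\<forall>B\<in>P. \<exists>c. \<forall>\<alpha>\<in>B. poly g \<alpha> = c"
  shows "has_locality A (evaluation_code A g r k) r"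
proof (rule has_localityI)
  fix i assume "i \<in> A"
  then obtain B where B: "B \<in> P" "i \<in> B" "B \<subseteq> A"
    using partition_onD1[OF assms(2)] by auto
  then obtain c where c: "\<And>\<alpha>. \<alpha> \<in> B \<Longrightarrow> poly g \<alpha> = c" using assms(4) by blast
  have "card B = r + 1" using B assms(3) by blast
  then have finB: "finite B" by (metis card.infinite add_is_0 zero_neq_one)
  have card: "card (B - {i}) = r" using \<open>card B = r + 1\<close> B finB by simp
  have "x i = y i" if x: "x \<in> evaluation_code A g r k" and y: "y \<in> evaluation_code A g r k"
    and agree: "\<forall>l\<in>B - {i}. x l = y l" for x y
  proof -
    obtain a b where ab: "x = evaluation_word A (encoding_poly g r k a)"
      "y = evaluation_word A (encoding_poly g r k b)"
      using x y by (auto simp: evaluation_code_def)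
    \<comment> \<open>This is the difference of the two encoding polynomials with \<open>g\<close>
      replaced by its constant value \<open>c\<close> on the block.\<close>
    define D where "D = (\<Sum>l<r. monom (\<Sum>j<k div r. (a (l, j) - b (l, j)) * c ^ j) l)"
    have D: "x \<alpha> - y \<alpha> = poly D \<alpha>" if "\<alpha> \<in> B" for \<alpha>
    proof -
      have "x \<alpha> - y \<alpha> = poly (encoding_poly g r k (\<lambda>p. a p - b p)) \<alpha>"
        using that B by (auto simp: ab evaluation_word_def encoding_poly_diff[symmetric])
      also have "\<dots> = poly D \<alpha>"
        using c[OF that] by (simp add: encoding_poly_def D_def poly_sum poly_monom)
      finally show ?thesis .
    qed
    have "degree D < r" unfolding D_def by (rule degree_sum_monom_less) (rule assms(1))
    moreover have "\<forall>\<alpha>\<in>B - {i}. poly D \<alpha> = 0"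
      using agree by (auto simp flip: D)
    ultimately have "D = 0"
      using card_roots_le_degree[of D "B - {i}"] card by linarith
    then show ?thesis using D[OF B(2)] by simp
  qed
  then show "\<exists>I. I \<subseteq> A \<and> i \<notin> I \<and> finite I \<and> card I \<le> r \<and>
      (\<forall>x\<in>evaluation_code A g r k. \<forall>y\<in>evaluation_code A g r k.
        (\<forall>l\<in>I. x l = y l) \<longrightarrow> x i = y i)"
    using B card finB by (intro exI[of _ "B - {i}"]) auto
qed

section \<open>Minimum distance\<close>

text \<open>The size bound on \<open>A\<close> provides \<open>k div r\<close> blocks. All but one
  of them consist of roots, and the remaining one contributes \<open>r - 1\<close> further roots,
  which matches the degree bound.\<close>

lemma exists_encoding_poly_many_roots:
  fixes g :: "'a::field poly"
  assumes "r \<ge> 1" "k \<ge> 1" "r dvd k" "finite A" "(r + 1) * (k div r) \<le> card A"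
    and "partition_on A P" "\<forall>B\<in>P. card B = r + 1" "degree g = r + 1"
    and "\<forall>B\<in>P. \<exists>c. \<forall>\<alpha>\<in>B. poly g \<alpha> = c"
  shows "\<exists>a. encoding_poly g r k a \<noteq> 0 \<and>
    k + k div r \<le> card {\<alpha> \<in> A. poly (encoding_poly g r k a) \<alpha> = 0} + 2"
proof -
  define m where "m = k div r"
  have k: "k = r * m" using assms(3) by (simp add: m_def)
  have m1: "m \<ge> 1" using k assms(2) by (cases m) auto
  have finP: "finite P" using assms(4,6) by (rule finite_elements)
  have finB: "finite B" if "B \<in> P" for B
    using that assms(4) partition_onD1[OF assms(6)] by (blast intro: finite_subset)
  have "card A = (\<Sum>B\<in>P. card B)"
    using product_partition[OF assms(6)] finB by simp
  also have "\<dots> = card P * (r + 1)" using assms(7) by simp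
  finally have "(r + 1) * m \<le> (r + 1) * card P" using assms(5) by (simp only: m_def mult.commute)
  then have "m \<le> card P" by (simp only: mult_le_cancel1)
  then obtain Q where Q: "Q \<subseteq> P" "card Q = m" "finite Q"
    using obtain_subset_with_card_n by metis
  then obtain B0 where B0: "B0 \<in> Q" using m1 by fastforce
  \<comment> \<open>The block \<open>B0\<close> is kept apart for the linear factors, so that their
    roots are disjoint from those of \<open>pcompose p g\<close>.\<close>
  define R where "R = Q - {B0}"
  have R: "R \<subseteq> P" "card R = m - 1" "finite R" "B0 \<notin> R" "B0 \<in> P"
    using Q B0 by (auto simp: R_def)
  obtain S where S: "S \<subseteq> B0" "card S = r - 1" "finite S"
    using obtain_subset_with_card_n[of "r - 1" B0] assms(7) R(5) by (metis diff_le_self le_add1 le_trans)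
  obtain c where c: "\<And>B \<alpha>. B \<in> P \<Longrightarrow> \<alpha> \<in> B \<Longrightarrow> poly g \<alpha> = c B"
    using assms(9) by metis
  \<comment> \<open>Substituting \<open>g\<close> for the variable turns the factors of
    \<open>p\<close> into \<open>g - c B\<close>, each vanishing on its block
    \<open>B\<close>.\<close>
  define p where "p = (\<Prod>B\<in>R. [:- c B, 1:])"
  define h where "h = (\<Prod>\<alpha>\<in>S. [:- \<alpha>, 1:])"
  have "degree p = m - 1" "degree h = r - 1"
    using R(2) S(2) by (simp_all add: p_def h_def degree_prod_eq_sum_degree)
  then have "degree p < k div r" "degree h < r"
    using m1 assms(1) by (auto simp: m_def[symmetric])
  then obtain a where a: "encoding_poly g r k a = pcompose p g * h"
    using pcompose_times_in_encoding by blast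
  \<comment> \<open>Since \<open>g\<close> has positive degree, composing it into the nonzero
    \<open>p\<close> cannot give zero.\<close>
  have nz: "pcompose p g * h \<noteq> 0"
    using R(3) S(3) assms(8) by (auto simp: p_def h_def pcompose_eq_0_iff)
  have roots: "\<Union>R \<union> S \<subseteq> {\<alpha> \<in> A. poly (encoding_poly g r k a) \<alpha> = 0}"
  proof -
    have "poly (pcompose p g) \<alpha> = 0" if "B \<in> R" "\<alpha> \<in> B" for B \<alpha>
    proof -
      have "poly g \<alpha> = c B" using c that R(1) by blast
      then show ?thesis using that R(3) by (auto simp: p_def poly_pcompose poly_prod prod_zero_iff)
    qed
    moreover have "poly h \<alpha> = 0" if "\<alpha> \<in> S" for \<alpha>
      using that S(3) by (auto simp: h_def poly_prod prod_zero_iff)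
    moreover have "\<Union>R \<union> S \<subseteq> A"
      using R(1,5) S(1) partition_onD1[OF assms(6)] by blast
    ultimately show ?thesis by (auto simp: a)
  qed
  \<comment> \<open>The roots are counted as points of pairwise disjoint sets: \<open>m - 1\<close>
    whole blocks of size \<open>r + 1\<close> and the set \<open>S\<close> of size
    \<open>r - 1\<close>, in total \<open>k + m - 2\<close>.\<close>
  have "card (\<Union>R \<union> S) = card (\<Union>R) + card S"
  proof (rule card_Un_disjoint)
    show "\<Union>R \<inter> S = {}"
      using partition_onD2[OF assms(6)] R S(1) by (fastforce simp: disjoint_def)
    show "finite (\<Union>R)"
      using R(1,3) finB by blast
  qed (rule S)
  also have "card (\<Union>R) = (\<Sum>B\<in>R. card B)"
    using R(1) partition_onD2[OF assms(6)] finB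
    by (intro card_Union_disjoint) (auto simp: disjoint_def pairwise_def disjnt_def)
  also have "\<dots> = (m - 1) * (r + 1)"
    using R(1,2) assms(7) by (simp add: subset_iff)
  finally have "card (\<Union>R \<union> S) = (m - 1) * (r + 1) + (r - 1)"
    using S(2) by simp
  moreover have "card (\<Union>R \<union> S) \<le> card {\<alpha> \<in> A. poly (encoding_poly g r k a) \<alpha> = 0}"
    using roots by (rule card_mono[rotated]) (simp add: assms(4))
  moreover obtain m' where "m = Suc m'" using m1 by (cases m) auto
  moreover obtain r' where "r = Suc r'" using assms(1) by (cases r) auto
  ultimately have "k + k div r \<le> card {\<alpha> \<in> A. poly (encoding_poly g r k a) \<alpha> = 0} + 2"
    unfolding m_def[symmetric] by (simp add: k algebra_simps)
  then show ?thesis using nz by (intro exI[of _ a]) (simp add: a)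
qed

text \<open>Two evaluation words agree exactly at the roots of \<open>f - h\<close> in
  \<open>A\<close>, so distances become root counts.\<close>

lemma hamming_distance_evaluation_word:
  fixes A :: "'a::field set"
  assumes "finite A"
  shows "hamming_distance A (evaluation_word A f) (evaluation_word A h)
    + card {\<alpha> \<in> A. poly (f - h) \<alpha> = 0} = card A"
proof -
  have "hamming_distance A (evaluation_word A f) (evaluation_word A h)
      = card {\<alpha> \<in> A. poly (f - h) \<alpha> \<noteq> 0}"
    unfolding hamming_distance_def
    by (rule arg_cong[where f = card]) (auto simp: evaluation_word_def)
  moreover have "card {\<alpha> \<in> A. poly (f - h) \<alpha> \<noteq> 0} + card {\<alpha> \<in> A. poly (f - h) \<alpha> = 0}
      = card ({\<alpha> \<in> A. poly (f - h) \<alpha> \<noteq> 0} \<union> {\<alpha> \<in> A. poly (f - h) \<alpha> = 0})"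
    by (rule card_Un_disjoint[symmetric]) (use assms in auto)
  moreover have "{\<alpha> \<in> A. poly (f - h) \<alpha> \<noteq> 0} \<union> {\<alpha> \<in> A. poly (f - h) \<alpha> = 0} = A"
    by auto
  ultimately show ?thesis by simp
qed

text \<open>The degree bound limits the agreements of any two distinct codewords to
  \<open>k + k div r - 2\<close>. The polynomial with many roots, compared with the zero word,
  reaches this number.\<close>

lemma min_distance_evaluation_code:
  fixes A :: "'a::{finite,field} set"
  assumes "r \<ge> 1" "k \<ge> 1" "r dvd k" "(r + 1) * (k div r) \<le> card A"
    and "partition_on A P" "\<forall>B\<in>P. card B = r + 1" "degree g = r + 1"
    and "\<forall>B\<in>P. \<exists>c. \<forall>\<alpha>\<in>B. poly g \<alpha> = c"
  shows "min_distance A (evaluation_code A g r k) + (k + k div r) = card A + 2"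
proof -
  define C where "C = evaluation_code A g r k"
  define W where "W = {hamming_distance A x y | x y. x \<in> C \<and> y \<in> C \<and> x \<noteq> y}"
  have "W \<subseteq> {..card A}"
    by (auto simp: W_def hamming_distance_def intro: card_mono)
  then have finW: "finite W" by (rule finite_subset) simp
  have kr: "k + k div r = (r + 1) * (k div r)" using assms(3) by (simp add: algebra_simps)
  have lower: "card A + 2 \<le> w + (k + k div r)" if "w \<in> W" for w
  proof -
    from that obtain x y where xy: "w = hamming_distance A x y" "x \<in> C" "y \<in> C" "x \<noteq> y"
      by (auto simp: W_def)
    then obtain a b where "x = evaluation_word A (encoding_poly g r k a)"
      "y = evaluation_word A (encoding_poly g r k b)"
      by (auto simp: C_def evaluation_code_def)
    with xy have w: "w = hamming_distance A (evaluation_word A (encoding_poly g r k a))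
        (evaluation_word A (encoding_poly g r k b))"
      and ne: "encoding_poly g r k a \<noteq> encoding_poly g r k b"
      by auto
    let ?d = "encoding_poly g r k (\<lambda>p. a p - b p)"
    have d: "?d = encoding_poly g r k a - encoding_poly g r k b"
      by (simp add: encoding_poly_diff)
    have "card {\<alpha> \<in> A. poly ?d \<alpha> = 0} \<le> degree ?d"
      using ne by (intro card_roots_le_degree) (auto simp: d)
    also have "\<dots> + 2 \<le> k + k div r"
      by (rule degree_encoding_poly) (use assms in auto)
    finally show ?thesis
      using hamming_distance_evaluation_word[of A "encoding_poly g r k a" "encoding_poly g r k b"]
      by (simp add: w d)
  qed
  obtain a where a: "encoding_poly g r k a \<noteq> 0"
    "k + k div r \<le> card {\<alpha> \<in> A. poly (encoding_poly g r k a) \<alpha> = 0} + 2"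
    using exists_encoding_poly_many_roots[of r k A P g] assms by auto
  have zero: "encoding_poly g r k (\<lambda>_. 0) = 0"
    by (simp add: encoding_poly_Times)
  define x where "x = evaluation_word A (encoding_poly g r k a)"
  define z where "z = evaluation_word A (encoding_poly g r k (\<lambda>_. 0))"
  have "x \<noteq> z"
  proof
    assume "x = z"
    then have "evaluation_word A (encoding_poly g r k a) = 0"
      by (auto simp: x_def z_def zero evaluation_word_def fun_eq_iff)
    \<comment> \<open>Here \<open>k + k div r = (r + 1) * (k div r) \<le> card A\<close>, so the
      degree is at most \<open>card A - 2\<close> and a nonzero polynomial has a nonzero
      word.\<close>
    moreover have "degree (encoding_poly g r k a) < card A"
      using degree_encoding_poly[of k r g a] assms kr by auto
    ultimately show False using evaluation_word_eq_0D a(1) by blast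
  qed
  then have mem: "hamming_distance A x z \<in> W"
    by (auto simp: W_def C_def x_def z_def intro: evaluation_word_encoding_poly_in_code)
  have upper: "hamming_distance A x z + (k + k div r) \<le> card A + 2"
    using hamming_distance_evaluation_word[of A "encoding_poly g r k a" "encoding_poly g r k (\<lambda>_. 0)"] a(2)
    by (simp add: x_def z_def zero)
  have "Min W \<in> W" using finW mem by (auto intro: Min_in)
  moreover have "Min W \<le> hamming_distance A x z" using finW mem by (rule Min_le)
  ultimately have "Min W + (k + k div r) = card A + 2"
    using lower upper by (meson add_le_mono1 le_antisym le_trans)
  then show ?thesis by (simp add: min_distance_def W_def C_def)
qed

theorem theorem3p1:
  fixes q n k r :: nat
    and A :: "'a::{finite,field} set"
    and P :: "'a set set"
    and g :: "'a poly"
  assumes "CARD('a) = q"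
    and "n \<ge> 1" and "k \<ge> 1" and "r \<ge> 1"
    and "n \<le> q"
    and "(r + 1) dvd n"
    and "r dvd k"
    and "real k \<le> real (r * n) / real (r + 1)"
    and "card A = n"
    and "partition_on A P"
    and "\<forall>B\<in>P. card B = r + 1"
    and "degree g = r + 1"
    and "\<forall>B\<in>P. \<exists>c. \<forall>\<alpha>\<in>B. poly g \<alpha> = c"
  shows "word.subspace (evaluation_code A g r k)
    \<and> word.dim (evaluation_code A g r k) = k
    \<and> optimal_lrc_code A (evaluation_code A g r k) n k r"
proof -
  define m where "m = k div r"
  have k: "k = r * m" using assms(7) by (simp add: m_def)
  \<comment> \<open>Clearing the denominator in the rate bound and cancelling \<open>r\<close> from
    \<open>k = r * m\<close> leaves \<open>(r + 1) * m \<le> n\<close>: there are at least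
    \<open>m\<close> blocks, and degrees stay below \<open>n\<close>.\<close>
  have "real k * real (r + 1) \<le> real (r * n)"
    using assms(8) by (simp add: pos_le_divide_eq)
  then have "k * (r + 1) \<le> r * n"
    by (simp only: of_nat_mult[symmetric] of_nat_le_iff)
  then have "r * ((r + 1) * m) \<le> r * n" using k by (simp add: algebra_simps)
  then have mn: "(r + 1) * m \<le> n" using assms(4) by simp
  have small: "k + k div r < card A + 2"
    using mn k assms(9) by (simp add: m_def[symmetric] algebra_simps)
  note basis = evaluation_code_basis[OF assms(3,4,7,12) small]
  have idx: "card ({..<r} \<times> {..<k div r}) = k"
    using k by (simp add: m_def)
  have "word.dim (evaluation_code A g r k) = k"
    unfolding basis(3) word.dim_span_eq_card_independent[OF basis(2)] card_image[OF basis(1)] by (rule idx)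
  moreover have "word.subspace (evaluation_code A g r k)"
    by (simp add: basis(3))
  moreover have "evaluation_code A g r k
      = (\<lambda>a. evaluation_word A (encoding_poly g r k a)) ` message_space r k"
    by (auto simp: evaluation_code_def)
  \<comment> \<open>The encoding is injective on messages, and these are the functions on
    \<open>k\<close> indices.\<close>
  then have "card (evaluation_code A g r k) = CARD('a) ^ k"
    using card_image[OF basis(4)] by (simp add: message_space_def card_PiE idx[simplified])
  moreover have "evaluation_code A g r k \<subseteq> word_space A"
    by (auto simp: evaluation_code_def word_space_def evaluation_word_def)
  moreover have "has_locality A (evaluation_code A g r k) r"
    using assms by (intro evaluation_code_has_locality)
  moreover have "min_distance A (evaluation_code A g r k) + (k + m) = n + 2"
    using min_distance_evaluation_code[of r k A P g] assms mn by (simp add: m_def)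
  \<comment> \<open>As \<open>r\<close> divides \<open>k\<close>, the ceiling in the optimal
    distance is \<open>m\<close> itself.\<close>
  moreover have "real k / real r = real m"
    using k assms(4) by simp
  ultimately show ?thesis
    using assms(9) by (simp add: optimal_lrc_code_def lrc_code_def)
qed

end
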